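(* Let $f:(-1,1)\to\mathbb{R}$ be defined by $f(x)=x^2\sin\left(\frac1x\right)$ for $x\in(-1,1)\setminus\{0\}$ and $f(0)=0$. Then $f$ is $L_1$-differentiable at $0$, but $0$ is not a $W^1_1$-differentiability point of $f$ (that is, $f$ is not $W^1_1$-differentiable at $0$).
   Context: The definitions below are given for an open set $\Omega\subset\mathbb{R}^n$ and $1\le p<\infty$; here $n=1$, $\Omega=(-1,1)$, $p=1$. $B(x,r)$ is the open ball with center $x$ and radius $r$. Precise representative: for $f\in L_{1,\mathrm{loc}}(\Omega)$, $f^*(x)=\lim_{r\to0^+}\frac{1}{|B(x,r)|}\int_{B(x,r)}f(y)\,dy$ if the limit exists and is real, and $f^*(x)=0$ otherwise. $L_p$-point: for $f\in L_{p,\mathrm{loc}}(\Omega)$, a point $x\in\Omega$ is an $L_p$-point of $f$ if the limit defining $f^*(x)$ exists in $\mathbb{R}$ and $\lim_{r\to 0^+}\frac{1}{|B(x,r)|}\int_{B(x,r)}|f(z)-f^*(x)|^p\,dz=0$. $L_p$-differentiability: $f\in L_{p,\mathrm{loc}}(\Omega)$ is $L_p$-differentiable at $x\in\Omega$ if there is a linear map $L:\mathbb{R}^n\to\mathbb{R}$ with $\lim_{r\to0^+}\frac{1}{|B(x,r)|}\int_{B(x,r)}\frac{|f(z)-f^*(x)-L(z-x)|^p}{r^p}\,dz=0$. Sobolev norm: $\|f\|_{W^1_p(U)}=\sum_{|\alpha|\le1}\|D^\alpha f\|_{L_p(U)}$, with weak derivatives. $W^1_p$-differentiability: for $f\in W^1_{p,\mathrm{loc}}(\Omega)$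 and $x\in\Omega$ an $L_p$-point of $f$, $f$ is $W^1_p$-differentiable at $x$ if there is a linear map $L:\mathbb{R}^n\to\mathbb{R}$ such that for every open bounded $U\subset\mathbb{R}^n$, $\lim_{h\to0}\|f_{x,h}-L\|_{W^1_p(U)}=0$, where $f_{x,h}(z)=\frac{f^*(x+hz)-f^*(x)}{h}$ for $h\in\mathbb{R}\setminus\{0\}$, $z\in\frac{\Omega-x}{h}$ (this is defined on $U$ for $|h|$ small). *)

theory Defs
  imports "HOL-Analysis.Analysis"
begin

text \<open>
  Throughout, \<open>\<Omega>\<close> and \<open>U\<close> are meant to be open subsets of a Euclidean space and
  \<open>1 \<le> p < \<infinity>\<close>. A function on \<open>\<Omega>\<close> is represented by a total function, of which
  only the values on \<open>\<Omega>\<close> matter.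
\<close>

section \<open>Lebesgue spaces\<close>

definition Lp_on :: "real \<Rightarrow> 'a::euclidean_space set \<Rightarrow> ('a \<Rightarrow> real) \<Rightarrow> bool" where
  "Lp_on p U f \<longleftrightarrow> f \<in> borel_measurable (lebesgue_on U) \<and>
     integrable (lebesgue_on U) (\<lambda>x. \<bar>f x\<bar> powr p)"

definition Lp_norm :: "real \<Rightarrow> 'a::euclidean_space set \<Rightarrow> ('a \<Rightarrow> real) \<Rightarrow> real" where
  "Lp_norm p U f = (LINT x|lebesgue_on U. \<bar>f x\<bar> powr p) powr (1 / p)"

definition Lp_loc :: "real \<Rightarrow> 'a::euclidean_space set \<Rightarrow> ('a \<Rightarrow> real) \<Rightarrow> bool" where
  "Lp_loc p \<Omega> f \<longleftrightarrow> (\<forall>K. compact K \<and> K \<subseteq> \<Omega> \<longrightarrow> Lp_on p K f)"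

section \<open>Precise representative, \<open>L\<^sub>p\<close>-points, \<open>L\<^sub>p\<close>-differentiability\<close>

definition ball_avg :: "('a::euclidean_space \<Rightarrow> real) \<Rightarrow> 'a \<Rightarrow> real \<Rightarrow> real" where
  "ball_avg f x r = (LINT y|lebesgue_on (ball x r). f y) / measure lebesgue (ball x r)"

definition has_avg_limit :: "('a::euclidean_space \<Rightarrow> real) \<Rightarrow> 'a \<Rightarrow> bool" where
  "has_avg_limit f x \<longleftrightarrow> (\<exists>l. (ball_avg f x \<longlongrightarrow> l) (at_right 0))"

definition precise_rep :: "('a::euclidean_space \<Rightarrow> real) \<Rightarrow> 'a \<Rightarrow> real" where
  "precise_rep f x = (if has_avg_limit f x then Lim (at_right 0) (ball_avg f x) else 0)"

definition Lp_point :: "real \<Rightarrow> 'a::euclidean_space set \<Rightarrow> ('a \<Rightarrow> real) \<Rightarrow> 'a \<Rightarrow> bool" where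
  "Lp_point p \<Omega> f x \<longleftrightarrow> Lp_loc p \<Omega> f \<and> x \<in> \<Omega> \<and> has_avg_limit f x \<and>
     (ball_avg (\<lambda>z. \<bar>f z - precise_rep f x\<bar> powr p) x \<longlongrightarrow> 0) (at_right 0)"

definition Lp_differentiable_at ::
  "real \<Rightarrow> 'a::euclidean_space set \<Rightarrow> ('a \<Rightarrow> real) \<Rightarrow> 'a \<Rightarrow> bool" where
  "Lp_differentiable_at p \<Omega> f x \<longleftrightarrow> Lp_loc p \<Omega> f \<and> x \<in> \<Omega> \<and>
     (\<exists>L. linear L \<and>
        ((\<lambda>r. ball_avg (\<lambda>z. \<bar>f z - precise_rep f x - L (z - x)\<bar> powr p / r powr p) x r)
          \<longlongrightarrow> 0) (at_right 0))"

section \<open>Weak derivatives and Sobolev spaces\<close>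

primrec Ck_fun :: "nat \<Rightarrow> ('a::euclidean_space \<Rightarrow> real) \<Rightarrow> bool" where
  "Ck_fun 0 f \<longleftrightarrow> continuous_on UNIV f"
| "Ck_fun (Suc k) f \<longleftrightarrow> f differentiable_on UNIV \<and>
     (\<forall>b\<in>Basis. Ck_fun k (\<lambda>x. frechet_derivative f (at x) b))"

definition test_fun :: "'a::euclidean_space set \<Rightarrow> ('a \<Rightarrow> real) \<Rightarrow> bool" where
  "test_fun \<Omega> \<phi> \<longleftrightarrow> (\<forall>k. Ck_fun k \<phi>) \<and>
     compact (closure {x. \<phi> x \<noteq> 0}) \<and> closure {x. \<phi> x \<noteq> 0} \<subseteq> \<Omega>"

definition is_weak_partial ::
  "'a::euclidean_space set \<Rightarrow> 'a \<Rightarrow> ('a \<Rightarrow> real) \<Rightarrow> ('a \<Rightarrow> real) \<Rightarrow> bool" where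
  "is_weak_partial \<Omega> b f g \<longleftrightarrow> Lp_loc 1 \<Omega> f \<and> Lp_loc 1 \<Omega> g \<and>
     (\<forall>\<phi>. test_fun \<Omega> \<phi> \<longrightarrow>
        (LINT x|lebesgue_on \<Omega>. f x * frechet_derivative \<phi> (at x) b) =
        - (LINT x|lebesgue_on \<Omega>. g x * \<phi> x))"

text \<open>Weak derivatives are unique only up to null sets; the choice does not affect norms.\<close>

definition weak_partial ::
  "'a::euclidean_space set \<Rightarrow> 'a \<Rightarrow> ('a \<Rightarrow> real) \<Rightarrow> 'a \<Rightarrow> real" where
  "weak_partial \<Omega> b f = (SOME g. is_weak_partial \<Omega> b f g)"

definition W1p_on :: "real \<Rightarrow> 'a::euclidean_space set \<Rightarrow> ('a \<Rightarrow> real) \<Rightarrow> bool" where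
  "W1p_on p U f \<longleftrightarrow> Lp_on p U f \<and> (\<forall>b\<in>Basis. \<exists>g. is_weak_partial U b f g \<and> Lp_on p U g)"

definition W1p_loc :: "real \<Rightarrow> 'a::euclidean_space set \<Rightarrow> ('a \<Rightarrow> real) \<Rightarrow> bool" where
  "W1p_loc p \<Omega> f \<longleftrightarrow>
     (\<forall>V. open V \<and> compact (closure V) \<and> closure V \<subseteq> \<Omega> \<longrightarrow> W1p_on p V f)"

text \<open>As with any total real-valued norm, the value is meaningful only on \<open>W1p_on p U\<close>.\<close>

definition W1p_norm :: "real \<Rightarrow> 'a::euclidean_space set \<Rightarrow> ('a \<Rightarrow> real) \<Rightarrow> real" where
  "W1p_norm p U f = Lp_norm p U f + (\<Sum>b\<in>Basis. Lp_norm p U (weak_partial U b f))"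

section \<open>\<open>W\<^sup>1\<^sub>p\<close>-differentiability\<close>

definition diff_quot ::
  "('a::euclidean_space \<Rightarrow> real) \<Rightarrow> 'a \<Rightarrow> real \<Rightarrow> 'a \<Rightarrow> real" where
  "diff_quot f x h z = (precise_rep f (x + h *\<^sub>R z) - precise_rep f x) / h"

text \<open>
  For bounded \<open>U\<close> and small \<open>h \<noteq> 0\<close> the set \<open>x + h U\<close> is compactly contained in
  \<open>\<Omega>\<close>. Hence the hypothesis \<open>W1p_loc p \<Omega> f\<close> makes \<open>diff_quot f x h - L\<close> an element
  of \<open>W1p_on p U\<close> for all small \<open>h \<noteq> 0\<close>, and the limit below only involves
  meaningful values of the norm.
\<close>

definition W1p_differentiable_at ::
  "real \<Rightarrow> 'a::euclidean_space set \<Rightarrow> ('a \<Rightarrow> real) \<Rightarrow> 'a \<Rightarrow> bool" where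
  "W1p_differentiable_at p \<Omega> f x \<longleftrightarrow> W1p_loc p \<Omega> f \<and> Lp_point p \<Omega> f x \<and>
     (\<exists>L. linear L \<and>
        (\<forall>U. open U \<and> bounded U \<longrightarrow>
           ((\<lambda>h. W1p_norm p U (\<lambda>z. diff_quot f x h z - L z)) \<longlongrightarrow> 0) (at 0)))"

end

theory Submission
  imports Defs
begin

text \<open>
  Since \<open>\<bar>f x\<bar> \<le> x\<^sup>2\<close>, the map \<open>L = 0\<close> is an \<open>L\<^sub>1\<close>-derivative at \<open>0\<close>. The classical derivative
  \<open>2 x sin (1 / x) - cos (1 / x)\<close> is bounded, hence it is the weak derivative of \<open>f\<close>. On
  \<open>U = (1, 2)\<close> the weak derivative of \<open>f\<^sub>0\<^sub>,\<^sub>h - L\<close> with \<open>L z = c z\<close> is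
  \<open>- cos (1 / (h z)) - c + O(h)\<close>. The cosine oscillates with mean \<open>0\<close> and mean square \<open>1 / 2\<close>, so
  the \<open>L\<^sub>1\<close> norm stays above \<open>(1 / 2 + c\<^sup>2) / (1 + \<bar>c\<bar>) - O(h)\<close>. As \<open>weak_partial\<close> is an arbitrary
  choice among the weak derivatives (and the integral of a non-integrable choice would be the junk
  value \<open>0\<close>), this needs almost everywhere uniqueness, which is obtained by testing against
  smooth functions that converge boundedly to the indicator of an interval.
\<close>

section \<open>Smooth approximations of the indicator of an interval\<close>

text \<open>\<open>Ck_fun\<close> speaks of all iterated derivatives, so the induction runs over a
  whole family: the derivative of a member is again a member. On the line \<open>Basis\<close>
  contains only 1, and the partial derivative is the ordinary one.\<close>

lemma Ck_fun_if_derivative_closed: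
  fixes f :: "real \<Rightarrow> real"
  assumes closed: "\<And>f. f \<in> S \<Longrightarrow> \<exists>f'\<in>S. \<forall>x. (f has_real_derivative f' x) (at x)"
    and "f \<in> S"
  shows "Ck_fun k f"
  using \<open>f \<in> S\<close>
proof (induction k arbitrary: f)
  case 0
  then show ?case
    using closed[of f] by (auto intro!: continuous_at_imp_continuous_on DERIV_isCont)
next
  case (Suc k)
  obtain f' where f': "f' \<in> S" "\<And>x. (f has_real_derivative f' x) (at x)"
    using closed[OF Suc.prems] by blast
  have d: "(f has_derivative (*) (f' x)) (at x)" for x
    using f'(2) by (simp add: has_field_derivative_def)
  have "frechet_derivative f (at x) = (*) (f' x)" for x
    using frechet_derivative_at[OF d] by simp
  moreover have "f differentiable_on UNIV"
    using d differentiable_def differentiable_on_def by blast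
  ultimately show ?case
    using Suc.IH[OF f'(1)] by (simp add: Basis_real_def)
qed

text \<open>The bound at \<open>y = x\<close> forces \<open>f x = 0\<close>, so the difference
  quotient is at most \<open>C * \<bar>h\<bar>\<close>. This serves where the differentiation rules
  break down: at the end points of a bump, and at 0 for the oscillating function.\<close>

lemma DERIV_zero_if_quadratic_bound:
  fixes f :: "real \<Rightarrow> real"
  assumes "\<And>y. \<bar>f y\<bar> \<le> C * (y - x)\<^sup>2"
  shows "(f has_real_derivative 0) (at x)"
proof -
  have fx: "f x = 0" using assms[of x] by simp
  have "((\<lambda>h. C * \<bar>h\<bar>) \<longlongrightarrow> 0) (at 0)"
    by (intro tendsto_eq_intros | simp)+
  moreover have "\<bar>(f (x + h) - f x) / h\<bar> \<le> C * \<bar>h\<bar>" if "h \<noteq> 0" for h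
  proof -
    have "\<bar>f (x + h)\<bar> \<le> C * \<bar>h\<bar> * \<bar>h\<bar>"
      using assms[of "x + h"] by (simp add: power2_eq_square abs_mult_self_eq mult.assoc)
    then show ?thesis using that fx by (simp add: abs_divide divide_le_eq)
  qed
  then have "\<forall>\<^sub>F h in at 0. norm ((f (x + h) - f x) / h) \<le> C * \<bar>h\<bar>"
    by (auto simp: eventually_at_filter simp del: abs_divide)
  ultimately have "((\<lambda>h. (f (x + h) - f x) / h) \<longlongrightarrow> 0) (at 0)"
    by (rule Lim_null_comparison[rotated])
  then show ?thesis by (simp add: DERIV_def)
qed

text \<open>Polynomials in \<open>1 / (x - a)\<close> and \<open>1 / (b - x)\<close>, the factors
  that repeated differentiation puts in front of the exponential in \<open>bump\<close>.\<close>

inductive_set amplitudes :: "real \<Rightarrow> real \<Rightarrow> (real \<Rightarrow> real) set" for a b where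
  const: "(\<lambda>x. c) \<in> amplitudes a b"
| left: "(\<lambda>x. 1 / (x - a)) \<in> amplitudes a b"
| right: "(\<lambda>x. 1 / (b - x)) \<in> amplitudes a b"
| add: "p \<in> amplitudes a b \<Longrightarrow> q \<in> amplitudes a b \<Longrightarrow> (\<lambda>x. p x + q x) \<in> amplitudes a b"
| mult: "p \<in> amplitudes a b \<Longrightarrow> q \<in> amplitudes a b \<Longrightarrow> (\<lambda>x. p x * q x) \<in> amplitudes a b"

lemma amplitudes_DERIV:
  assumes "p \<in> amplitudes a b"
  shows "\<exists>p'\<in>amplitudes a b. \<forall>x\<in>{a<..<b}. (p has_real_derivative p' x) (at x)"
  using assms
proof induction
  case (const c)
  show ?case by (rule bexI[OF _ amplitudes.const[of 0]]) auto
next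
  case left
  have "(\<lambda>x. -1 * (1 / (x - a) * (1 / (x - a)))) \<in> amplitudes a b"
    by (rule amplitudes.mult amplitudes.const amplitudes.left)+
  then show ?case
    by (rule bexI[rotated]) (auto intro!: derivative_eq_intros simp: divide_simps)
next
  case right
  have "(\<lambda>x. 1 / (b - x) * (1 / (b - x))) \<in> amplitudes a b"
    by (rule amplitudes.mult amplitudes.right)+
  then show ?case
    by (rule bexI[rotated]) (auto intro!: derivative_eq_intros simp: divide_simps)
next
  case (add p q)
  obtain p' where p': "p' \<in> amplitudes a b"
    "\<And>x. x\<in>{a<..<b} \<Longrightarrow> (p has_real_derivative p' x) (at x)" using add.IH(1) by blast
  obtain q' where q': "q' \<in> amplitudes a b"
    "\<And>x. x\<in>{a<..<b} \<Longrightarrow> (q has_real_derivative q' x) (at x)" using add.IH(2) by blast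
  show ?case
    by (rule bexI[OF _ amplitudes.add[OF p'(1) q'(1)]]) (auto intro: DERIV_add p'(2) q'(2))
next
  case (mult p q)
  obtain p' where p': "p' \<in> amplitudes a b"
    "\<And>x. x\<in>{a<..<b} \<Longrightarrow> (p has_real_derivative p' x) (at x)" using mult.IH(1) by blast
  obtain q' where q': "q' \<in> amplitudes a b"
    "\<And>x. x\<in>{a<..<b} \<Longrightarrow> (q has_real_derivative q' x) (at x)" using mult.IH(2) by blast
  show ?case
    by (rule bexI[OF _ amplitudes.add[OF amplitudes.mult[OF p'(1) mult.hyps(2)] amplitudes.mult[OF q'(1) mult.hyps(1)]]])
       (auto intro: DERIV_mult p'(2) q'(2))
qed

text \<open>On the interval the base is at least 1, so both terms of a sum can be raised to the
  common exponent \<open>m + n\<close>; in a product the exponents add.\<close>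

lemma amplitudes_growth:
  assumes "p \<in> amplitudes a b"
  shows "\<exists>C m. C \<ge> 0 \<and> (\<forall>x\<in>{a<..<b}. \<bar>p x\<bar> \<le> C * (1 + 1 / (x - a) + 1 / (b - x)) ^ m)"
  using assms
proof induction
  case (const c)
  show ?case by (intro exI[of _ "\<bar>c\<bar>"] exI[of _ 0]) simp
next
  case left
  show ?case by (intro exI[of _ 1]) (auto simp: add_nonneg_nonneg intro!: exI[of _ 1])
next
  case right
  show ?case by (intro exI[of _ 1]) (auto simp: add_nonneg_nonneg intro!: exI[of _ 1])
next
  case (add p q)
  obtain C m where p: "C \<ge> 0"
    "\<And>x. x\<in>{a<..<b} \<Longrightarrow> \<bar>p x\<bar> \<le> C * (1 + 1 / (x - a) + 1 / (b - x)) ^ m"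
    using add.IH(1) by blast
  obtain D n where q: "D \<ge> 0"
    "\<And>x. x\<in>{a<..<b} \<Longrightarrow> \<bar>q x\<bar> \<le> D * (1 + 1 / (x - a) + 1 / (b - x)) ^ n"
    using add.IH(2) by blast
  show ?case
  proof (intro exI[of _ "C + D"] exI[of _ "m + n"] conjI ballI)
    fix x assume x: "x \<in> {a<..<b}"
    define t where "t = 1 + 1 / (x - a) + 1 / (b - x)"
    have t: "t \<ge> 1" using x by (simp add: t_def)
    have "C * t ^ m \<le> C * t ^ (m + n)" "D * t ^ n \<le> D * t ^ (m + n)"
      using t p q by (auto intro!: mult_left_mono power_increasing)
    then have "\<bar>p x + q x\<bar> \<le> (C + D) * t ^ (m + n)"
      using p(2)[OF x, folded t_def] q(2)[OF x, folded t_def]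
      unfolding distrib_right by linarith
    then show "\<bar>p x + q x\<bar> \<le> (C + D) * (1 + 1 / (x - a) + 1 / (b - x)) ^ (m + n)"
      by (simp only: t_def)
  qed (use p(1) q(1) in simp)
next
  case (mult p q)
  obtain C m where p: "C \<ge> 0"
    "\<And>x. x\<in>{a<..<b} \<Longrightarrow> \<bar>p x\<bar> \<le> C * (1 + 1 / (x - a) + 1 / (b - x)) ^ m"
    using mult.IH(1) by blast
  obtain D n where q: "D \<ge> 0"
    "\<And>x. x\<in>{a<..<b} \<Longrightarrow> \<bar>q x\<bar> \<le> D * (1 + 1 / (x - a) + 1 / (b - x)) ^ n"
    using mult.IH(2) by blast
  show ?case
  proof (intro exI[of _ "C * D"] exI[of _ "m + n"] conjI ballI)
    fix x assume x: "x \<in> {a<..<b}"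
    show "\<bar>p x * q x\<bar> \<le> C * D * (1 + 1 / (x - a) + 1 / (b - x)) ^ (m + n)"
      using mult_mono'[OF p(2)[OF x] q(2)[OF x]] by (simp add: abs_mult power_add mult_ac)
  qed (use p(1) q(1) in simp)
qed

text \<open>The parameter \<epsilon> takes the place of a mollification radius: as it tends to 0,
  the bumps increase to the indicator of the open interval.\<close>

definition bump :: "real \<Rightarrow> real \<Rightarrow> real \<Rightarrow> real \<Rightarrow> real" where
  "bump a b \<epsilon> x = (if a < x \<and> x < b then exp (- \<epsilon> * (1 / (x - a) + 1 / (b - x))) else 0)"

text \<open>Since \<open>exp\<close> beats every power, the amplitude is absorbed up to the quadratic decay
  that makes the derivative vanish at the end points.\<close>

lemma amplitude_bump_quadratic_decay:
  assumes "p \<in> amplitudes a b" "\<epsilon> > 0"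
  shows "\<exists>C. \<forall>x. \<bar>p x * bump a b \<epsilon> x\<bar> \<le> C * (x - a)\<^sup>2 \<and> \<bar>p x * bump a b \<epsilon> x\<bar> \<le> C * (x - b)\<^sup>2"
proof -
  obtain C m where C: "C \<ge> 0"
    "\<And>x. x\<in>{a<..<b} \<Longrightarrow> \<bar>p x\<bar> \<le> C * (1 + 1 / (x - a) + 1 / (b - x)) ^ m"
    using amplitudes_growth[OF assms(1)] by metis
  \<comment> \<open>Of the \<open>N\<close> inverse powers of \<open>t\<close>, \<open>m\<close>
    cancel the growth of \<open>p\<close> and two remain as the quadratic decay.\<close>
  define N where "N = m + 2"
  have N_pos: "N > 0" by (simp add: N_def)
  define K where "K = C * exp \<epsilon> * (N / \<epsilon>) ^ N"
  have K: "K \<ge> 0" using C assms by (simp add: K_def)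
  have "\<bar>p x * bump a b \<epsilon> x\<bar> \<le> K * (x - a)\<^sup>2 \<and> \<bar>p x * bump a b \<epsilon> x\<bar> \<le> K * (x - b)\<^sup>2" for x
  proof (cases "x \<in> {a<..<b}")
    case False
    then show ?thesis using K by (auto simp: bump_def)
  next
    case True
    define t where "t = 1 + 1 / (x - a) + 1 / (b - x)"
    have t: "t \<ge> 1" using True by (simp add: t_def)
    \<comment> \<open>The bound \<open>y \<le> exp y\<close> at
      \<open>y = \<epsilon> * t / N\<close>, raised to the power \<open>N\<close>, makes
      \<open>exp (\<epsilon> * t)\<close> dominate a multiple of \<open>t ^ N\<close>.\<close>
    have "\<epsilon> * t / N \<le> exp (\<epsilon> * t / N)"
      using exp_ge_add_one_self[of "\<epsilon> * t / N"] by linarith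
    then have "(\<epsilon> * t / N) ^ N \<le> exp (\<epsilon> * t / N) ^ N"
      using t assms by (intro power_mono) auto
    also have "\<dots> = exp (\<epsilon> * t)"
      by (simp add: exp_of_nat_mult[symmetric] N_pos)
    finally have "inverse (exp (\<epsilon> * t)) \<le> inverse ((\<epsilon> * t / N) ^ N)"
      using t assms N_pos by (intro le_imp_inverse_le) simp_all
    also have "\<dots> = inverse (\<epsilon> * t / N) ^ N"
      by (simp only: power_inverse)
    also have "inverse (\<epsilon> * t / N) = N / \<epsilon> / t"
      by simp
    finally have e: "exp (- (\<epsilon> * t)) \<le> (N / \<epsilon>) ^ N / t ^ N"
      by (simp only: exp_minus power_divide)
    \<comment> \<open>The summand 1 of \<open>t\<close> is missing from the exponent of the bump;
      this costs the factor \<open>exp \<epsilon>\<close> in \<open>K\<close>.\<close>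
    have "bump a b \<epsilon> x = exp \<epsilon> * exp (- (\<epsilon> * t))"
      using True by (simp add: bump_def t_def exp_add[symmetric] algebra_simps)
    then have "\<bar>p x * bump a b \<epsilon> x\<bar> = \<bar>p x\<bar> * (exp \<epsilon> * exp (- (\<epsilon> * t)))"
      by (simp add: abs_mult)
    also have "\<dots> \<le> (C * t ^ m) * (exp \<epsilon> * ((N / \<epsilon>) ^ N / t ^ N))"
      using C(2)[OF True] e by (intro mult_mono) (auto simp: t_def)
    also have "\<dots> = K * (t ^ m / t ^ N)"
      by (simp add: K_def)
    also have "t ^ m / t ^ N = (1 / t)\<^sup>2"
      using t by (simp add: N_def power_add power_one_over power2_eq_square)
    finally have le: "\<bar>p x * bump a b \<epsilon> x\<bar> \<le> K * (1 / t)\<^sup>2" .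
    have "1 / (x - a) \<le> t" "1 / (b - x) \<le> t" using True by (auto simp: t_def)
    then have "1 / t \<le> x - a" "1 / t \<le> b - x"
      using True t by (auto simp: field_simps)
    then have "(1 / t)\<^sup>2 \<le> (x - a)\<^sup>2" "(1 / t)\<^sup>2 \<le> (x - b)\<^sup>2"
      using t by (auto simp: power2_commute[of x b] intro!: power_mono)
    then show ?thesis using le K by (meson mult_left_mono order_trans)
  qed
  then show ?thesis by blast
qed

lemma amplitude_bump_DERIV:
  assumes p: "p \<in> amplitudes a b" and "\<epsilon> > 0"
  shows "\<exists>p'\<in>amplitudes a b. \<forall>x. ((\<lambda>x. p x * bump a b \<epsilon> x) has_real_derivative p' x * bump a b \<epsilon> x) (at x)"
proof -
  obtain q where q: "q \<in> amplitudes a b"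
    "\<And>x. x\<in>{a<..<b} \<Longrightarrow> (p has_real_derivative q x) (at x)"
    using amplitudes_DERIV[OF p] by blast
  \<comment> \<open>Product rule: \<open>p\<close> is multiplied by the derivative of the exponent,
    spelled out in generators so that the introduction rules of \<open>amplitudes\<close>
    apply.\<close>
  define p' where "p' = (\<lambda>x. q x + p x * (\<epsilon> * (1 / (x - a) * (1 / (x - a)) + -1 * (1 / (b - x) * (1 / (b - x))))))"
  have "p' \<in> amplitudes a b"
    unfolding p'_def
    by (rule amplitudes.add amplitudes.mult amplitudes.const amplitudes.left amplitudes.right p q(1))+
  moreover have "((\<lambda>x. p x * bump a b \<epsilon> x) has_real_derivative p' x * bump a b \<epsilon> x) (at x)" for x
  proof -
    obtain C where C: "\<And>x. \<bar>p x * bump a b \<epsilon> x\<bar> \<le> C * (x - a)\<^sup>2"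
        "\<And>x. \<bar>p x * bump a b \<epsilon> x\<bar> \<le> C * (x - b)\<^sup>2"
      using amplitude_bump_quadratic_decay[OF assms] by blast
    consider "x \<in> {a<..<b}" | "x = a" | "x = b" | "x \<in> - {a..b}" by fastforce
    then show ?thesis
    proof cases
      case 1
      define D where "D = \<epsilon> * (1 / (x - a) * (1 / (x - a)) + -1 * (1 / (b - x) * (1 / (b - x))))"
      have "((\<lambda>x. - \<epsilon> * (1 / (x - a) + 1 / (b - x))) has_real_derivative D) (at x)"
        unfolding D_def using 1
        by (auto intro!: derivative_eq_intros simp: power2_eq_square right_diff_distrib mult.commute)
      from DERIV_mult'[OF q(2)[OF 1] DERIV_fun_exp[OF this]]
      have "((\<lambda>x. p x * exp (- \<epsilon> * (1 / (x - a) + 1 / (b - x)))) has_real_derivative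
          p' x * exp (- \<epsilon> * (1 / (x - a) + 1 / (b - x)))) (at x)"
        by (rule DERIV_cong) (simp only: p'_def D_def[symmetric], simp add: distrib_right mult_ac)
      then have "((\<lambda>x. p x * bump a b \<epsilon> x) has_real_derivative
          p' x * exp (- \<epsilon> * (1 / (x - a) + 1 / (b - x)))) (at x)"
        by (rule has_field_derivative_transform_within_open[OF _ open_greaterThanLessThan 1])
           (auto simp: bump_def)
      then show ?thesis using 1 by (simp add: bump_def)
    next
      \<comment> \<open>At an end point the bump vanishes, so the claimed derivative is 0 whatever
        default value \<open>p'\<close> takes there.\<close>
      case 2
      then show ?thesis
        using DERIV_zero_if_quadratic_bound[OF C(1)] by (simp add: bump_def)
    next
      case 3
      then show ?thesis
        using DERIV_zero_if_quadratic_bound[OF C(2)] by (simp add: bump_def)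
    next
      case 4
      have "((\<lambda>x. p x * bump a b \<epsilon> x) has_real_derivative 0) (at x)"
        by (rule has_field_derivative_transform_within_open[OF DERIV_const[of 0] _ 4])
           (auto simp: bump_def)
      then show ?thesis using 4 by (auto simp: bump_def)
    qed
  qed
  ultimately show ?thesis by blast
qed

text \<open>Amplitudes times the bump form a class closed under differentiation, and the constant
  amplitude 1 gives the bump itself. For \<open>b \<le> a\<close> the bump is the zero function, a
  case that occurs in the uniqueness proof.\<close>

lemma test_fun_bump:
  assumes "\<epsilon> > 0" "{a..b} \<subseteq> V"
  shows "test_fun V (bump a b \<epsilon>)"
proof -
  have "Ck_fun k (bump a b \<epsilon>)" for k
  proof (rule Ck_fun_if_derivative_closed)
    show "bump a b \<epsilon> \<in> {\<lambda>x. p x * bump a b \<epsilon> x |p. p \<in> amplitudes a b}"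
      using amplitudes.const[of 1 a b] by force
    show "\<exists>f'\<in>{\<lambda>x. p x * bump a b \<epsilon> x |p. p \<in> amplitudes a b}. \<forall>x. (f has_real_derivative f' x) (at x)"
      if f: "f \<in> {\<lambda>x. p x * bump a b \<epsilon> x |p. p \<in> amplitudes a b}" for f
    proof -
      obtain p where p: "p \<in> amplitudes a b" "f = (\<lambda>x. p x * bump a b \<epsilon> x)"
        using f by blast
      then show ?thesis using amplitude_bump_DERIV[OF p(1) assms(1)] by auto
    qed
  qed
  moreover have "closure {x. bump a b \<epsilon> x \<noteq> 0} \<subseteq> {a..b}"
    by (intro closure_minimal) (auto simp: bump_def)
  moreover from this have "compact (closure {x. bump a b \<epsilon> x \<noteq> 0})"
    by (metis bounded_closed_interval bounded_subset closed_closure compact_eq_bounded_closed)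
  ultimately show ?thesis using assms(2) by (auto simp: test_fun_def)
qed

section \<open>Weak derivatives on the real line\<close>

lemma Lp_on_1_iff: "Lp_on 1 U f \<longleftrightarrow> integrable (lebesgue_on U) f"
  using integrable_norm_iff[of f "lebesgue_on U"] by (auto simp: Lp_on_def borel_measurable_integrable)

lemma integrable_lebesgue_on_if_bounded:
  fixes f :: "'a::euclidean_space \<Rightarrow> real"
  assumes "S \<in> lmeasurable" "f \<in> borel_measurable (lebesgue_on S)" "\<And>x. x \<in> S \<Longrightarrow> \<bar>f x\<bar> \<le> B"
  shows "integrable (lebesgue_on S) f"
proof (rule finite_measure.integrable_const_bound[OF finite_measure_lebesgue_on[OF assms(1)] _ assms(2)])
  show "AE x in lebesgue_on S. norm (f x) \<le> B" using assms(3) by (intro AE_I2) simp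
qed

lemma Lp_loc_1_if_continuous_on:
  assumes "continuous_on \<Omega> f"
  shows "Lp_loc 1 \<Omega> f"
  unfolding Lp_loc_def Lp_on_1_iff
proof (intro allI impI, elim conjE)
  fix K assume K: "compact K" "K \<subseteq> \<Omega>"
  have c: "continuous_on K f" using assms K(2) by (rule continuous_on_subset)
  obtain B where "\<And>x. x \<in> K \<Longrightarrow> \<bar>f x\<bar> \<le> B"
    using compact_imp_bounded[OF compact_continuous_image[OF c K(1)]] by (auto simp: bounded_iff)
  moreover have "K \<in> lmeasurable" using K(1) by (rule lmeasurable_compact)
  ultimately show "integrable (lebesgue_on K) f"
    using c by (intro integrable_lebesgue_on_if_bounded continuous_imp_measurable_on_sets_lebesgue) auto
qed

section \<open>Almost everywhere uniqueness of weak derivatives\<close>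

text \<open>Half-lines are an intersection-stable generator of the Borel sets, so by Dynkin's
  argument the integral vanishes over every Borel set, and such a density is 0 almost everywhere.
  The Borel version \<open>v\<close> of \<open>w\<close> moves the argument from
  \<open>lebesgue\<close> to \<open>lborel\<close>.\<close>

lemma AE_zero_if_zero_on_halflines:
  fixes w :: "real \<Rightarrow> real"
  assumes int: "integrable lebesgue w" and zero: "\<And>y. (LINT x:{..y}|lebesgue. w x) = 0"
  shows "AE x in lebesgue. w x = 0"
proof -
  have "w \<in> borel_measurable (completion lborel)"
    using int by (simp add: borel_measurable_integrable)
  then obtain v where v[measurable]: "v \<in> borel_measurable lborel" and wv: "AE x in lborel. w x = v x"
    using completion_ex_borel_measurable_real by blast
  have wv': "AE x in lebesgue. w x = v x" using wv by (rule AE_completion)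
  have "integrable lebesgue v"
    using int by (rule integrable_cong_AE_imp) (use wv' v in \<open>auto intro: measurable_completion\<close>)
  then have v_int: "integrable lborel v" by (simp add: integrable_completion)
  have half: "(LINT x:{..y}|lborel. v x) = 0" for y
  proof -
    have "(LINT x:{..y}|lborel. v x) = (LINT x:{..y}|lebesgue. v x)"
      unfolding set_lebesgue_integral_def by (rule integral_completion[symmetric]) measurable
    also have "\<dots> = (LINT x:{..y}|lebesgue. w x)"
      unfolding set_lebesgue_integral_def
    proof (rule integral_cong_AE)
      show "AE x in lebesgue. indicator {..y} x *\<^sub>R v x = indicator {..y} x *\<^sub>R w x"
        using wv' by eventually_elim simp
    qed (use measurable_completion[OF v] borel_measurable_integrable[OF int] in
        \<open>auto intro!: borel_measurable_times borel_measurable_indicator\<close>)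
    finally show ?thesis using zero by simp
  qed
  \<comment> \<open>Half-lines exhaust the line; the complement step of the induction below uses the
    total integral.\<close>
  have total: "(LINT x|lborel. v x) = 0"
  proof -
    have "((\<lambda>y. LINT x|lborel. indicator {..y} x *\<^sub>R v x) \<longlongrightarrow> (LINT x|lborel. v x)) at_top"
      by (rule tendsto_integral_at_top) (use v_int in auto)
    then show ?thesis
      using half by (simp add: set_lebesgue_integral_def tendsto_const_iff)
  qed
  have set_int: "set_integrable lborel A v" if "A \<in> sets borel" for A
    using v_int that unfolding set_integrable_def by (intro integrable_mult_indicator) auto
  have "(LINT x:A|lborel. v x) = 0" if "A \<in> sets lborel" for A
  proof -
    have sb: "B \<in> sets borel" if "B \<in> sigma_sets UNIV (range (\<lambda>y::real. {..y}))" for B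
      using that by (simp add: borel_eq_atMost)
    have "Int_stable (range (\<lambda>y::real. {..y}))"
      by (auto simp: Int_stable_def)
    moreover have "range (\<lambda>y::real. {..y}) \<subseteq> Pow UNIV" by simp
    moreover have "A \<in> sigma_sets UNIV (range (\<lambda>y::real. {..y}))"
      using that by (simp add: borel_eq_atMost)
    ultimately show ?thesis
    proof (induction rule: sigma_sets_induct_disjoint)
      case (basic A)
      then show ?case using half by auto
    next
      case empty
      then show ?case by (simp add: set_lebesgue_integral_def)
    next
      case (compl A)
      have "(LINT x:A \<union> (UNIV - A)|lborel. v x) = (LINT x:A|lborel. v x) + (LINT x:UNIV - A|lborel. v x)"
        using sb[OF compl(1)] by (intro set_integral_Un set_int) auto
      then show ?case
        using compl total by (simp add: set_lebesgue_integral_def)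
    next
      case (union A)
      have m: "A i \<in> sets borel" for i using sb union(2) by blast
      have "(LINT x:(\<Union>i. A i)|lborel. v x) = (\<Sum>i. (LINT x:(A i)|lborel. v x))"
        using union(1) m
        by (intro lebesgue_integral_countable_add set_int) (auto simp: disjoint_family_on_def)
      then show ?case using union by simp
    qed
  qed
  with v_int have "AE x in lborel. v x = 0" by (rule sigma_finite_measure.density_zero[OF sigma_finite_lborel])
  then have "AE x in lebesgue. v x = 0" by (rule AE_completion)
  with wv' show ?thesis by eventually_elim simp
qed

lemma bump_bounds: "\<epsilon> > 0 \<Longrightarrow> 0 \<le> bump a b \<epsilon> x \<and> bump a b \<epsilon> x \<le> 1"
  by (auto simp: bump_def)

lemma test_fun_continuous: "test_fun V \<phi> \<Longrightarrow> continuous_on UNIV \<phi>"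
  using Ck_fun.simps(1)[of \<phi>] unfolding test_fun_def by blast

lemma bump_tendsto_indicator:
  "(\<lambda>n. bump a b (1 / real (Suc n)) x) \<longlonglongrightarrow> indicator {a<..<b} x"
proof (cases "x \<in> {a<..<b}")
  case True
  have "(\<lambda>n. exp (- (1 / real (Suc n)) * (1 / (x - a) + 1 / (b - x)))) \<longlonglongrightarrow> exp (- 0 * (1 / (x - a) + 1 / (b - x)))"
    using LIMSEQ_inverse_real_of_nat by (intro tendsto_intros) (simp add: inverse_eq_divide)
  then show ?thesis using True by (simp add: bump_def)
qed (auto simp: bump_def)

lemma integrable_times_bounded:
  fixes g \<phi> :: "'a::euclidean_space \<Rightarrow> real"
  assumes g: "integrable (lebesgue_on K) g" and \<phi>: "continuous_on K \<phi>" and K: "compact K"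
  shows "integrable (lebesgue_on K) (\<lambda>x. g x * \<phi> x)"
proof -
  obtain B where B: "\<And>x. x \<in> K \<Longrightarrow> \<bar>\<phi> x\<bar> \<le> B"
    using compact_imp_bounded[OF compact_continuous_image[OF \<phi> K]] by (auto simp: bounded_iff)
  have Ks: "K \<in> sets lebesgue" using K by (simp add: lmeasurable_compact fmeasurableD)
  show ?thesis
  proof (rule measurable_bounded_by_integrable_imp_lebesgue_integrable[OF _ _ _ Ks])
    show "(\<lambda>x. g x * \<phi> x) \<in> borel_measurable (lebesgue_on K)"
      using g \<phi> Ks by (intro borel_measurable_times borel_measurable_integrable
          continuous_imp_measurable_on_sets_lebesgue)
    show "integrable (lebesgue_on K) (\<lambda>x. \<bar>g x\<bar> * B)" using g by simp
    show "norm (g x * \<phi> x) \<le> \<bar>g x\<bar> * B" if "x \<in> K" for x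
      using B[OF that] by (simp add: abs_mult mult_left_mono)
  qed
qed

text \<open>\<open>g\<close> and \<open>h\<close> have equal integrals against every bump supported
  in \<open>V\<close>. As \<epsilon> tends to 0, dominated convergence gives equal integrals over
  intervals, so the half-line criterion applies on each compact interval in \<open>V\<close>;
  countably many of these cover \<open>V\<close>.\<close>

lemma weak_partial_unique:
  fixes g h :: "real \<Rightarrow> real"
  assumes V: "open V" and g: "is_weak_partial V 1 f g" and h: "is_weak_partial V 1 f h"
  shows "AE x in lebesgue_on V. g x = h x"
proof -
  have Vs: "V \<in> sets lebesgue" using V by auto
  \<comment> \<open>\<open>g\<close> and \<open>h\<close> are only locally integrable on
    \<open>V\<close>; the difference, cut off outside a compact interval, is integrable on the whole
    line.\<close>
  have local: "AE x in lebesgue. x \<in> cbox a b \<longrightarrow> g x = h x" if ab: "cbox a b \<subseteq> V" for a b :: real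
  proof -
    define K where "K = {a..b}"
    have K: "compact K" "K \<subseteq> V" and Ks: "K \<in> sets lebesgue" using ab by (auto simp: K_def)
    define D where "D x = (if x \<in> K then g x - h x else 0)" for x
    have gi: "integrable (lebesgue_on K) g" and hi: "integrable (lebesgue_on K) h"
      using g h K by (auto simp: is_weak_partial_def Lp_loc_def Lp_on_1_iff)
    then have D: "integrable lebesgue D"
      unfolding D_def using Ks by (subst Lebesgue_Measure.integrable_restrict_UNIV) auto
    then have [measurable]: "D \<in> borel_measurable lebesgue" by (rule borel_measurable_integrable)
    have bump: "(LINT x|lebesgue. D x * bump a y \<epsilon> x) = 0" if "\<epsilon> > 0" "y \<le> b" for y \<epsilon>
    proof -
      have sub: "{a..y} \<subseteq> V" using that K(2) by (auto simp: K_def)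
      have tf: "test_fun V (bump a y \<epsilon>)" by (rule test_fun_bump[OF that(1) sub])
      have c: "continuous_on K (bump a y \<epsilon>)"
        using test_fun_continuous[OF tf] continuous_on_subset by blast
      \<comment> \<open>For \<open>y \<le> b\<close> the bump vanishes outside \<open>K\<close>, so
        integrals over \<open>V\<close> reduce to integrals over \<open>K\<close>.\<close>
      have restr: "(LINT x|lebesgue_on V. k x * bump a y \<epsilon> x) = (LINT x|lebesgue_on K. k x * bump a y \<epsilon> x)"
        for k :: "real \<Rightarrow> real"
      proof -
        have "(\<lambda>x. k x * bump a y \<epsilon> x) = (\<lambda>x. if x \<in> K then k x * bump a y \<epsilon> x else 0)"
          using that(2) by (auto simp: bump_def K_def)
        then show ?thesis
          using integral_restrict[OF K(2) Ks Vs, of "\<lambda>x. k x * bump a y \<epsilon> x"] by simp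
      qed
      have "(LINT x|lebesgue_on V. g x * bump a y \<epsilon> x) = (LINT x|lebesgue_on V. h x * bump a y \<epsilon> x)"
        using g h tf unfolding is_weak_partial_def by fastforce
      then have "0 = (LINT x|lebesgue_on K. g x * bump a y \<epsilon> x) - (LINT x|lebesgue_on K. h x * bump a y \<epsilon> x)"
        by (simp add: restr)
      also have "\<dots> = (LINT x|lebesgue_on K. (g x - h x) * bump a y \<epsilon> x)"
        using gi hi c K(1) by (simp add: left_diff_distrib integrable_times_bounded)
      also have "\<dots> = (LINT x|lebesgue. (if x \<in> K then (g x - h x) * bump a y \<epsilon> x else 0))"
        using Ks by (simp add: Lebesgue_Measure.integral_restrict_UNIV)
      also have "\<dots> = (LINT x|lebesgue. D x * bump a y \<epsilon> x)"
        by (intro Bochner_Integration.integral_cong) (auto simp: D_def)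
      finally show ?thesis by simp
    qed
    have bm: "bump a y \<epsilon> \<in> borel_measurable lebesgue" if "\<epsilon> > 0" for y \<epsilon>
      using test_fun_continuous[OF test_fun_bump[OF that subset_UNIV]]
      by (simp add: borel_measurable_continuous_onI measurable_completion)
    have ivl: "(LINT x|lebesgue. D x * indicator {a<..<y} x) = 0" if "y \<le> b" for y
    proof -
      have "(\<lambda>n. LINT x|lebesgue. D x * bump a y (1 / real (Suc n)) x) \<longlonglongrightarrow>
          (LINT x|lebesgue. D x * indicator {a<..<y} x)"
      proof (rule integral_dominated_convergence)
        show "integrable lebesgue (\<lambda>x. \<bar>D x\<bar>)" using D by simp
        show "AE x in lebesgue. (\<lambda>n. D x * bump a y (1 / real (Suc n)) x) \<longlonglongrightarrow> D x * indicator {a<..<y} x"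
          by (intro AE_I2 tendsto_mult tendsto_const bump_tendsto_indicator)
        show "AE x in lebesgue. norm (D x * bump a y (1 / real (Suc n)) x) \<le> \<bar>D x\<bar>" for n
          using bump_bounds[of "1 / real (Suc n)" a y]
          by (intro AE_I2) (auto simp: abs_mult intro!: mult_left_le)
        show "(\<lambda>x. D x * bump a y (1 / real (Suc n)) x) \<in> borel_measurable lebesgue" for n
          by (intro borel_measurable_times bm) auto
        show "(\<lambda>x. D x * indicator {a<..<y} x) \<in> borel_measurable lebesgue"
          by (intro borel_measurable_times borel_measurable_indicator) auto
      qed
      then show ?thesis using bump[OF _ that] by (simp add: LIMSEQ_const_iff)
    qed
    have "AE x in lebesgue. D x = 0"
    proof (rule AE_zero_if_zero_on_halflines[OF D])
      fix y
      \<comment> \<open>Within \<open>K\<close>, the half-line and the open interval up to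
        \<open>min y b\<close> differ at most in the two excluded points.\<close>
      have "AE x in lebesgue. x \<noteq> a \<and> x \<noteq> min y b"
        by (intro AE_completion AE_conjI AE_lborel_singleton)
      then have "AE x in lebesgue. indicator {..y} x *\<^sub>R D x = D x * indicator {a<..<min y b} x"
        by eventually_elim (auto simp: D_def K_def indicator_def)
      then have "(LINT x:{..y}|lebesgue. D x) = (LINT x|lebesgue. D x * indicator {a<..<min y b} x)"
        unfolding set_lebesgue_integral_def
        by (intro integral_cong_AE borel_measurable_scaleR borel_measurable_times borel_measurable_indicator) auto
      then show "(LINT x:{..y}|lebesgue. D x) = 0" using ivl[of "min y b"] by simp
    qed
    then show ?thesis by eventually_elim (auto simp: D_def K_def)
  qed
  obtain C where C: "countable C" "C \<subseteq> Pow V" "\<And>X. X \<in> C \<Longrightarrow> \<exists>a b. X = cbox a b" "\<Union>C = V"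
    using open_countable_Union_open_cbox[OF V] by metis
  have "AE x in lebesgue. \<forall>X\<in>C. x \<in> X \<longrightarrow> g x = h x"
    unfolding AE_ball_countable[OF C(1)] using local C(2,3) by blast
  then have "AE x in lebesgue. x \<in> V \<longrightarrow> g x = h x"
    by eventually_elim (use C(4) in blast)
  then show ?thesis using Vs by (simp add: AE_restrict_space_iff)
qed

section \<open>Classical derivatives as weak derivatives\<close>

text \<open>Integration by parts: \<open>u * \<phi>\<close> has compact support, so its derivative
  integrates to 0 over a large interval. The fundamental theorem for the gauge integral asks only
  for a derivative at every point, which admits a discontinuous \<open>v\<close> such as
  \<open>osc_deriv\<close>; local integrability then gives a Lebesgue integral that can be
  split.\<close>

lemma is_weak_partial_if_DERIV:
  fixes u v :: "real \<Rightarrow> real"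
  assumes V: "open V" and uv: "\<And>x. x \<in> V \<Longrightarrow> (u has_real_derivative v x) (at x)"
    and v: "Lp_loc 1 V v"
  shows "is_weak_partial V 1 u v"
proof -
  have Vs: "V \<in> sets lebesgue" using V by auto
  have cu: "continuous_on V u"
    using uv by (auto intro!: continuous_at_imp_continuous_on DERIV_isCont)
  have u: "Lp_loc 1 V u" by (rule Lp_loc_1_if_continuous_on[OF cu])
  have "(LINT x|lebesgue_on V. u x * frechet_derivative \<phi> (at x) 1) = - (LINT x|lebesgue_on V. v x * \<phi> x)"
    if \<phi>: "test_fun V \<phi>" for \<phi>
  proof -
    define \<psi> where "\<psi> x = frechet_derivative \<phi> (at x) 1" for x
    define K where "K = closure {x. \<phi> x \<noteq> 0}"
    have K: "compact K" "K \<subseteq> V" using \<phi> by (auto simp: test_fun_def K_def)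
    have Ks: "K \<in> sets lebesgue" using K by (simp add: lmeasurable_compact fmeasurableD)
    have "Ck_fun (Suc 0) \<phi>" using \<phi> unfolding test_fun_def by blast
    then have diff: "\<phi> differentiable (at x)" and c\<psi>: "continuous_on UNIV \<psi>" for x
      by (auto simp: \<psi>_def[abs_def] Basis_real_def differentiable_on_def)
    have d: "(\<phi> has_real_derivative \<psi> x) (at x)" for x
    proof -
      obtain c where c: "(\<phi> has_real_derivative c) (at x)"
        using diff real_differentiable_def by blast
      then have "(*) c = frechet_derivative \<phi> (at x)"
        by (intro frechet_derivative_at) (simp add: has_field_derivative_def)
      then have "\<psi> x = c" by (metis \<psi>_def mult.right_neutral)
      then show ?thesis using c by simp
    qed
    \<comment> \<open>Outside \<open>V\<close> nothing is known about \<open>u\<close>, but off the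
      closed set \<open>K\<close> the factor \<open>\<phi>\<close> is 0 in a whole neighbourhood,
      and so is the product.\<close>
    have out: "\<phi> x = 0" "\<psi> x = 0" "((\<lambda>x. u x * \<phi> x) has_real_derivative 0) (at x)" if "x \<notin> K" for x
    proof -
      have z: "\<phi> y = 0" if "y \<in> - K" for y
        using that closure_subset[of "{x. \<phi> x \<noteq> 0}"] by (auto simp: K_def)
      have o: "open (- K)" "x \<in> - K" using that by (auto simp: K_def)
      show "\<phi> x = 0" using z o by blast
      have "(\<phi> has_real_derivative 0) (at x)"
        by (rule has_field_derivative_transform_within_open[OF DERIV_const[of 0] o]) (simp add: z)
      then show "\<psi> x = 0" using d DERIV_unique by blast
      show "((\<lambda>x. u x * \<phi> x) has_real_derivative 0) (at x)"
        by (rule has_field_derivative_transform_within_open[OF DERIV_const[of 0] o]) (simp add: z)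
    qed
    have dH: "((\<lambda>x. u x * \<phi> x) has_real_derivative u x * \<psi> x + v x * \<phi> x) (at x)" for x
    proof (cases "x \<in> K")
      case True
      then show ?thesis using DERIV_mult[OF uv[of x] d] K(2) by (auto simp: add.commute mult.commute)
    qed (use out in simp)
    obtain R where R: "R > 0" "K \<subseteq> ball 0 R"
      using bounded_subset_ballD[OF compact_imp_bounded[OF K(1)]] by blast
    then have "R \<notin> K" "-R \<notin> K" and KR: "K \<subseteq> {-R..R}" by force+
    then have ends: "\<phi> R = 0" "\<phi> (-R) = 0" using out(1) by blast+
    have "((\<lambda>x. u x * \<psi> x + v x * \<phi> x) has_integral u R * \<phi> R - u (-R) * \<phi> (-R)) {-R..R}"
      using R(1) dH by (intro fundamental_theorem_of_calculus)
        (auto simp: has_real_derivative_iff_has_vector_derivative intro: has_vector_derivative_at_within)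
    moreover have "(\<lambda>x. u x * \<psi> x + v x * \<phi> x) = (\<lambda>x. if x \<in> K then u x * \<psi> x + v x * \<phi> x else 0)"
      using out by auto
    ultimately have "((\<lambda>x. if x \<in> K then u x * \<psi> x + v x * \<phi> x else 0) has_integral 0) {-R..R}"
      using ends by simp
    then have hi: "((\<lambda>x. u x * \<psi> x + v x * \<phi> x) has_integral 0) K"
      using has_integral_restrict[OF KR] by blast
    have iu: "integrable (lebesgue_on K) (\<lambda>x. u x * \<psi> x)"
      and iv: "integrable (lebesgue_on K) (\<lambda>x. v x * \<phi> x)"
      using u v K c\<psi> test_fun_continuous[OF \<phi>]
      by (auto simp: Lp_loc_def Lp_on_1_iff intro!: integrable_times_bounded intro: continuous_on_subset)
    have restr: "(LINT x|lebesgue_on V. k x) = (LINT x|lebesgue_on K. k x)"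
      if "\<And>x. x \<notin> K \<Longrightarrow> k x = 0" for k :: "real \<Rightarrow> real"
    proof -
      have "k = (\<lambda>x. if x \<in> K then k x else 0)" using that by auto
      then show ?thesis
        using integral_restrict[OF K(2) Ks Vs, of k] by simp
    qed
    have "(LINT x|lebesgue_on V. u x * \<psi> x) + (LINT x|lebesgue_on V. v x * \<phi> x)
        = (LINT x|lebesgue_on K. u x * \<psi> x + v x * \<phi> x)"
      using iu iv out by (simp add: restr)
    also have "\<dots> = 0"
      using lebesgue_integral_eq_integral[of K "\<lambda>x. u x * \<psi> x + v x * \<phi> x"] iu iv Ks hi
      by (simp add: integral_unique)
    finally show ?thesis by (simp add: \<psi>_def)
  qed
  then show ?thesis using u v by (simp add: is_weak_partial_def)
qed

section \<open>Ball averages of continuous functions\<close>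

lemma abs_ball_avg_le:
  assumes "r > 0" "\<And>z. z \<in> ball x r \<Longrightarrow> \<bar>f z\<bar> \<le> B"
  shows "\<bar>ball_avg f x r\<bar> \<le> B"
proof -
  have B: "B \<ge> 0" using assms(2)[of x] assms(1) by simp
  have m: "measure lebesgue (ball x r) > 0" using assms(1) by (simp add: measure_completion content_ball_pos)
  have "\<bar>LINT y|lebesgue_on (ball x r). f y\<bar> \<le> (LINT y|lebesgue_on (ball x r). \<bar>f y\<bar>)"
    by (rule integral_abs_bound)
  \<comment> \<open>For a non-integrable \<open>f\<close> the left integral may have the default
    value 0; \<open>B \<ge> 0\<close> keeps the inequality true.\<close>
  also have "\<dots> \<le> (LINT y|lebesgue_on (ball x r). B)"
    using assms(2) B finite_measure_lebesgue_on[OF lmeasurable_ball]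
    by (intro Bochner_Integration.integral_mono') (auto intro: finite_measure.integrable_const)
  also have "\<dots> = measure lebesgue (ball x r) * B"
    by (simp add: measure_restrict_space)
  finally show ?thesis using m by (simp add: ball_avg_def abs_divide divide_le_eq mult.commute)
qed

lemma ball_avg_tendsto:
  assumes "open \<Omega>" "continuous_on \<Omega> f" "x \<in> \<Omega>"
  shows "(ball_avg f x \<longlongrightarrow> f x) (at_right 0)"
proof (rule tendstoI)
  fix e :: real assume e: "e > 0"
  have "continuous (at x) f" using assms by (simp add: continuous_on_eq_continuous_at)
  then obtain d where d: "d > 0" "\<And>z. dist z x < d \<Longrightarrow> dist (f z) (f x) < e / 2"
    using e unfolding continuous_at_eps_delta by (auto dest: spec[of _ "e / 2"])
  obtain s where s: "s > 0" "ball x s \<subseteq> \<Omega>" using assms openE by blast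
  have "dist (ball_avg f x r) (f x) < e" if r: "0 < r" "r < min d s" for r
  proof -
    have near: "\<bar>f z - f x\<bar> \<le> e / 2" if "z \<in> ball x r" for z
      using d(2)[of z] that r by (simp add: dist_commute dist_real_def abs_minus_commute)
    have m: "measure lebesgue (ball x r) > 0" using r by (simp add: measure_completion content_ball_pos)
    have c: "continuous_on (ball x r) f"
      using assms(2) by (rule continuous_on_subset) (use s r in auto)
    have i: "integrable (lebesgue_on (ball x r)) f"
    proof (rule integrable_lebesgue_on_if_bounded)
      show "\<bar>f z\<bar> \<le> \<bar>f x\<bar> + e / 2" if "z \<in> ball x r" for z using near[OF that] by linarith
    qed (use c in \<open>auto intro!: continuous_imp_measurable_on_sets_lebesgue\<close>)
    \<comment> \<open>Averaging is linear and fixes constants, so the error is the average of the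
      deviation from \<open>f x\<close>.\<close>
    have "ball_avg (\<lambda>z. f z - f x) x r = ball_avg f x r - f x"
      using i m finite_measure.integrable_const[OF finite_measure_lebesgue_on[OF lmeasurable_ball[of x r]]]
      by (subst ball_avg_def, subst Bochner_Integration.integral_diff)
        (auto simp: ball_avg_def measure_restrict_space diff_divide_distrib)
    moreover have "\<bar>ball_avg (\<lambda>z. f z - f x) x r\<bar> \<le> e / 2"
      by (rule abs_ball_avg_le[OF r(1) near])
    ultimately show ?thesis using e by (simp add: dist_real_def)
  qed
  then show "\<forall>\<^sub>F r in at_right 0. dist (ball_avg f x r) (f x) < e"
    using d(1) s(1) by (auto simp: eventually_at_right_field intro!: exI[of _ "min d s"])
qed

lemma precise_rep_eq:
  assumes "open \<Omega>" "continuous_on \<Omega> f" "x \<in> \<Omega>"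
  shows "has_avg_limit f x" "precise_rep f x = f x"
  using ball_avg_tendsto[OF assms] tendsto_Lim[OF trivial_limit_at_right_real]
  by (auto simp: has_avg_limit_def precise_rep_def)

lemma Lp_point_1_if_continuous_on:
  assumes "open \<Omega>" "continuous_on \<Omega> f" "x \<in> \<Omega>"
  shows "Lp_point 1 \<Omega> f x"
proof -
  have "continuous_on \<Omega> (\<lambda>z. \<bar>f z - f x\<bar>)" by (intro continuous_intros assms)
  from ball_avg_tendsto[OF assms(1) this assms(3)] show ?thesis
    using assms by (simp add: Lp_point_def Lp_loc_1_if_continuous_on precise_rep_eq)
qed

section \<open>The oscillating function\<close>

text \<open>The value at 0 is the true derivative there; the formula, with \<open>1 / 0 = 0\<close>,
  would give -1.\<close>

definition osc_deriv :: "real \<Rightarrow> real" where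
  "osc_deriv x = (if x = 0 then 0 else 2 * x * sin (1 / x) - cos (1 / x))"

text \<open>As \<open>1 / 0 = 0\<close>, the formula is 0 at 0, where the quadratic bound settles
  the derivative; elsewhere the product and chain rules apply.\<close>

lemma DERIV_osc: "((\<lambda>x. x\<^sup>2 * sin (1 / x)) has_real_derivative osc_deriv x) (at x)"
proof (cases "x = 0")
  case True
  have "\<bar>y\<^sup>2 * sin (1 / y)\<bar> \<le> 1 * (y - 0)\<^sup>2" for y :: real
    by (simp add: abs_mult mult_left_le)
  from DERIV_zero_if_quadratic_bound[OF this] show ?thesis
    using True by (simp add: osc_deriv_def)
next
  case False
  have "((\<lambda>x. 1 / x) has_real_derivative - (1 / x\<^sup>2)) (at x)"
    using False by (auto intro!: derivative_eq_intros simp: power2_eq_square)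
  from DERIV_mult[OF DERIV_power[OF DERIV_ident, of 2] DERIV_fun_sin[OF this]]
  show ?thesis
    by (rule DERIV_cong) (use False in \<open>simp add: osc_deriv_def field_simps\<close>)
qed

lemma abs_osc_deriv_le: "\<bar>osc_deriv x\<bar> \<le> 2 * \<bar>x\<bar> + 1"
proof -
  have "\<bar>2 * x * sin (1 / x)\<bar> \<le> 2 * \<bar>x\<bar>" by (simp add: abs_mult mult_left_le)
  moreover have "\<bar>cos (1 / x)\<bar> \<le> 1" by simp
  ultimately show ?thesis unfolding osc_deriv_def by (auto simp del: abs_cos_le_one)
qed

lemma borel_measurable_osc_deriv [measurable]: "osc_deriv \<in> borel_measurable borel"
  unfolding osc_deriv_def[abs_def] by measurable

lemma borel_measurable_lebesgue_on_if_borel: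
  fixes f :: "'a::euclidean_space \<Rightarrow> 'b::topological_space"
  assumes "f \<in> borel_measurable borel"
  shows "f \<in> borel_measurable (lebesgue_on S)"
  using assms by (intro measurable_restrict_space1 measurable_completion) simp

section \<open>Oscillatory integrals\<close>

text \<open>The integrand \<open>cos (k / z)\<close> is the derivative of \<open>- z\<^sup>2 sin (k / z) / k\<close> up to a term of
  size \<open>O(1 / k)\<close>.\<close>

lemma abs_integral_cos_le:
  fixes k :: real
  assumes k: "k > 0"
  shows "\<bar>integral {1..2} (\<lambda>z. cos (k / z))\<bar> \<le> 9 / k"
proof -
  let ?F = "\<lambda>z. - (z\<^sup>2 * sin (k / z)) / k"
  let ?r = "\<lambda>z. 2 * z * sin (k / z) / k"
  have d: "(?F has_real_derivative cos (k / z) - ?r z) (at z)" if "z \<in> {1..2}" for z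
  proof -
    have "((\<lambda>z. k / z) has_real_derivative - (k / z\<^sup>2)) (at z)"
      using that by (auto intro!: derivative_eq_intros simp: power2_eq_square)
    from DERIV_cdivide[OF DERIV_minus[OF DERIV_mult[OF DERIV_power[OF DERIV_ident, of 2] DERIV_fun_sin[OF this]]], of k]
    show ?thesis
      by (rule DERIV_cong) (use that k in \<open>simp add: field_simps\<close>)
  qed
  have "((\<lambda>z. cos (k / z) - ?r z) has_integral ?F 2 - ?F 1) {1..2}"
    using d by (intro fundamental_theorem_of_calculus)
      (auto simp: has_real_derivative_iff_has_vector_derivative intro: has_vector_derivative_at_within)
  then have "integral {1..2} (\<lambda>z. cos (k / z) - ?r z) = ?F 2 - ?F 1" by (rule integral_unique)
  moreover have c: "(\<lambda>z. cos (k / z)) integrable_on {1..2}" "?r integrable_on {1..2}"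
    by (intro integrable_continuous_interval continuous_intros; use k in force)+
  ultimately have "integral {1..2} (\<lambda>z. cos (k / z)) = ?F 2 - ?F 1 + integral {1..2} ?r"
    by (simp add: Henstock_Kurzweil_Integration.integral_diff)
  moreover have "\<bar>?F 2\<bar> \<le> 4 / k" "\<bar>?F 1\<bar> \<le> 1 / k"
    using k by (simp_all add: abs_mult divide_right_mono)
  moreover have "norm (integral {1..2} ?r) \<le> 4 / k * (2 - 1)"
  proof (rule integral_bound)
    show "continuous_on {1..2} ?r"
      by (intro continuous_intros) (use k in auto)
    fix z :: real assume z: "z \<in> {1..2}"
    then have "\<bar>z\<bar> * \<bar>sin (k / z)\<bar> \<le> 2 * 1" by (intro mult_mono) auto
    then show "norm (?r z) \<le> 4 / k"
      using k by (simp add: abs_mult divide_right_mono)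
  qed simp
  ultimately have "\<bar>integral {1..2} (\<lambda>z. cos (k / z))\<bar> \<le> \<bar>?F 2\<bar> + \<bar>?F 1\<bar> + \<bar>integral {1..2} ?r\<bar>"
      "\<bar>?F 2\<bar> \<le> 4 / k" "\<bar>?F 1\<bar> \<le> 1 / k" "\<bar>integral {1..2} ?r\<bar> \<le> 4 / k"
    by (linarith, blast+, simp)
  \<comment> \<open>The boundary terms at 2 and 1 contribute \<open>4 / k\<close> and
    \<open>1 / k\<close>, the remainder another \<open>4 / k\<close>.\<close>
  then have "\<bar>integral {1..2} (\<lambda>z. cos (k / z))\<bar> \<le> 4 / k + 1 / k + 4 / k"
    by linarith
  then show ?thesis by simp
qed

text \<open>Doubling the angle turns the square into \<open>1 / 2 + c\<^sup>2\<close> plus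
  oscillating terms of frequencies \<open>2 / h\<close> and \<open>1 / h\<close>. Their integrals
  are at most \<open>9 * h / 2\<close> and \<open>9 * h\<close>; the weights \<open>1 / 2\<close>
  and \<open>2 * c\<close> give \<open>9 / 4\<close> and \<open>18 * \<bar>c\<bar>\<close>.\<close>

lemma integral_cos_plus_const_square_ge:
  fixes c h :: real
  assumes h: "h > 0"
  shows "1 / 2 + c\<^sup>2 - (9 / 4 + 18 * \<bar>c\<bar>) * h \<le> integral {1..2} (\<lambda>z. (cos (1 / (h * z)) + c)\<^sup>2)"
proof -
  define I where "I k = integral {1..2} (\<lambda>z. cos (k / z))" for k :: real
  have I: "((\<lambda>z. cos (k / z)) has_integral I k) {1..2}" for k :: real
    unfolding I_def by (intro integrable_integral integrable_continuous_interval continuous_intros) auto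
  have sq: "(cos (1 / (h * z)) + c)\<^sup>2 = (1 / 2 + c\<^sup>2) + (cos ((2 / h) / z) / 2 + 2 * c * cos ((1 / h) / z))" for z
  proof -
    have eq: "1 / (h * z) = (1 / h) / z" "(2 / h) / z = 2 * ((1 / h) / z)" by simp_all
    show ?thesis
      unfolding eq cos_double_cos by (simp add: power2_sum diff_divide_distrib)
  qed
  have "((\<lambda>z. 1 / 2 + c\<^sup>2) has_integral (1 / 2 + c\<^sup>2)) {1..2::real}"
    using has_integral_const_real[of "1 / 2 + c\<^sup>2" 1 2] by simp
  from has_integral_add[OF this has_integral_add[OF
      has_integral_divide[OF I[of "2 / h"], of 2] has_integral_mult_right[OF I[of "1 / h"], of "2 * c"]]]
  have "integral {1..2} (\<lambda>z. (cos (1 / (h * z)) + c)\<^sup>2) = (1 / 2 + c\<^sup>2) + (I (2 / h) / 2 + 2 * c * I (1 / h))"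
    unfolding sq by (rule integral_unique)
  moreover have "\<bar>I (2 / h)\<bar> \<le> 9 * h / 2"
    using abs_integral_cos_le[of "2 / h"] h by (simp add: I_def)
  moreover have "\<bar>2 * c * I (1 / h)\<bar> \<le> 2 * \<bar>c\<bar> * (9 * h)"
  proof -
    have "\<bar>I (1 / h)\<bar> \<le> 9 * h"
      using abs_integral_cos_le[of "1 / h"] h by (simp add: I_def)
    from mult_left_mono[OF this, of "2 * \<bar>c\<bar>"] show ?thesis by (simp add: abs_mult)
  qed
  moreover have "(9 / 4 + 18 * \<bar>c\<bar>) * h = 9 * h / 2 / 2 + 2 * \<bar>c\<bar> * (9 * h)"
    by (simp add: algebra_simps)
  ultimately show ?thesis by linarith
qed

lemma integrable_osc_deriv:
  assumes S: "S \<in> lmeasurable" "bounded S"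
  shows "integrable (lebesgue_on S) (\<lambda>z. osc_deriv (h * z) - c)"
proof -
  obtain B where B: "\<And>z. z \<in> S \<Longrightarrow> \<bar>z\<bar> \<le> B" using S(2) by (auto simp: bounded_iff)
  show ?thesis
  proof (rule integrable_lebesgue_on_if_bounded[OF S(1)])
    show "(\<lambda>z. osc_deriv (h * z) - c) \<in> borel_measurable (lebesgue_on S)"
      by (rule borel_measurable_lebesgue_on_if_borel) measurable
    show "\<bar>osc_deriv (h * z) - c\<bar> \<le> 2 * (\<bar>h\<bar> * B) + 1 + \<bar>c\<bar>" if "z \<in> S" for z
    proof -
      have "\<bar>h * z\<bar> \<le> \<bar>h\<bar> * B" unfolding abs_mult using B[OF that] by (intro mult_left_mono) auto
      then show ?thesis using abs_osc_deriv_le[of "h * z"] by linarith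
    qed
  qed
qed

text \<open>Here \<open>\<bar>s\<bar> \<le> 1 + \<bar>c\<bar>\<close> for \<open>s = cos (1 / (h z)) + c\<close> turns the \<open>L\<^sub>1\<close> norm of \<open>s\<close> into its
  square mean.\<close>

lemma integral_abs_osc_deriv_ge:
  fixes c h :: real
  assumes h: "h > 0"
  shows "(1 / 2 + c\<^sup>2 - (9 / 4 + 18 * \<bar>c\<bar>) * h) / (1 + \<bar>c\<bar>) - 4 * h
      \<le> (LINT z|lebesgue_on {1<..<2}. \<bar>osc_deriv (h * z) - c\<bar>)"
proof -
  let ?U = "{1<..<2::real}"
  let ?s = "\<lambda>z. cos (1 / (h * z)) + c"
  \<comment> \<open>The subtracted \<open>4 * h\<close> accounts for the small term of
    \<open>osc_deriv\<close>, since \<open>z < 2\<close>.\<close>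
  let ?l = "\<lambda>z. (?s z)\<^sup>2 / (1 + \<bar>c\<bar>) - 4 * h"
  have U: "?U \<in> lmeasurable" by simp
  have i: "integrable (lebesgue_on ?U) (\<lambda>z. osc_deriv (h * z) - c)"
    by (rule integrable_osc_deriv) auto
  have s: "\<bar>?s z\<bar> \<le> 1 + \<bar>c\<bar>" for z
    using abs_triangle_ineq[of "cos (1 / (h * z))" c] abs_cos_le_one[of "1 / (h * z)"] by linarith
  have sq: "(?s z)\<^sup>2 / (1 + \<bar>c\<bar>) \<le> \<bar>?s z\<bar>" for z
  proof -
    have "(?s z)\<^sup>2 = \<bar>?s z\<bar> * \<bar>?s z\<bar>" by (simp add: power2_eq_square)
    also have "\<dots> \<le> \<bar>?s z\<bar> * (1 + \<bar>c\<bar>)" by (intro mult_left_mono s) simp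
    finally show ?thesis by (simp add: divide_le_eq)
  qed
  have cl: "continuous_on {1..2} (\<lambda>z. (?s z)\<^sup>2)"
    by (intro continuous_intros) (use h in auto)
  have il: "integrable (lebesgue_on ?U) ?l"
  proof (rule integrable_lebesgue_on_if_bounded[OF U])
    show "?l \<in> borel_measurable (lebesgue_on ?U)"
      by (rule borel_measurable_lebesgue_on_if_borel) measurable
    show "\<bar>?l z\<bar> \<le> 1 + \<bar>c\<bar> + 4 * h" for z
    proof -
      have "0 \<le> (?s z)\<^sup>2 / (1 + \<bar>c\<bar>)" by simp
      then show ?thesis using s[of z] sq[of z] h by linarith
    qed
  qed
  have "(1 / 2 + c\<^sup>2 - (9 / 4 + 18 * \<bar>c\<bar>) * h) / (1 + \<bar>c\<bar>) - 4 * h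
      \<le> integral {1..2} (\<lambda>z. (?s z)\<^sup>2) / (1 + \<bar>c\<bar>) - 4 * h"
    using integral_cos_plus_const_square_ge[OF h, of c] by (simp add: divide_right_mono)
  also have "\<dots> = integral {1..2} ?l"
  proof -
    have "(?l has_integral integral {1..2} (\<lambda>z. (?s z)\<^sup>2) / (1 + \<bar>c\<bar>) - 4 * h * (2 - 1)) {1..2}"
      using has_integral_const_real[of "4 * h" 1 2] cl
      by (intro has_integral_diff has_integral_divide integrable_integral integrable_continuous_interval)
        simp_all
    then show ?thesis by (simp add: integral_unique)
  qed
  also have "\<dots> = integral ?U ?l" by (rule integral_open_interval_real)
  also have "\<dots> = (LINT z|lebesgue_on ?U. ?l z)"
    using il by (intro lebesgue_integral_eq_integral[symmetric]) auto
  also have "\<dots> \<le> (LINT z|lebesgue_on ?U. \<bar>osc_deriv (h * z) - c\<bar>)"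
  proof (rule Bochner_Integration.integral_mono)
    fix z assume "z \<in> space (lebesgue_on ?U)"
    then have z: "1 < z" "z < 2" by auto
    have "\<bar>2 * (h * z) * sin (1 / (h * z))\<bar> \<le> 4 * h"
    proof -
      have "\<bar>h * z\<bar> * \<bar>sin (1 / (h * z))\<bar> \<le> (2 * h) * 1"
        using z h by (intro mult_mono) (auto simp: abs_mult)
      then show ?thesis by (simp add: abs_mult)
    qed
    moreover have "osc_deriv (h * z) - c = 2 * (h * z) * sin (1 / (h * z)) - ?s z"
      using z h by (simp add: osc_deriv_def)
    ultimately show "?l z \<le> \<bar>osc_deriv (h * z) - c\<bar>" using sq[of z] by linarith
  qed (use i il in auto)
  finally show "(1 / 2 + c\<^sup>2 - (9 / 4 + 18 * \<bar>c\<bar>) * h) / (1 + \<bar>c\<bar>) - 4 * h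
      \<le> (LINT z|lebesgue_on ?U. \<bar>osc_deriv (h * z) - c\<bar>)" .
qed

section \<open>The counterexample\<close>

lemma Lp_norm_1: "Lp_norm 1 U f = (LINT x|lebesgue_on U. \<bar>f x\<bar>)"
  by (simp add: Lp_norm_def)

theorem proposition3p6:
  fixes f :: "real \<Rightarrow> real"
  assumes "\<And>x. x \<in> {-1<..<1} - {0} \<Longrightarrow> f x = x\<^sup>2 * sin (1 / x)"
    and "f 0 = 0"
  shows "Lp_differentiable_at 1 {-1<..<1} f 0 \<and>
    W1p_loc 1 {-1<..<1} f \<and> Lp_point 1 {-1<..<1} f 0 \<and>
    \<not> W1p_differentiable_at 1 {-1<..<1} f 0"
proof -
  let ?\<Omega> = "{-1<..<1::real}"
  \<comment> \<open>The convention \<open>1 / 0 = 0\<close> makes the formula valid at 0 as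
    well.\<close>
  have f: "f x = x\<^sup>2 * sin (1 / x)" if "x \<in> ?\<Omega>" for x
    using assms that by (cases "x = 0") auto
  have df: "(f has_real_derivative osc_deriv x) (at x)" if "x \<in> ?\<Omega>" for x
    by (rule has_field_derivative_transform_within_open[OF DERIV_osc _ that]) (auto simp: f)
  have cf: "continuous_on ?\<Omega> f"
    using DERIV_isCont[OF df] by (blast intro: continuous_at_imp_continuous_on)
  have pr: "precise_rep f x = f x" if "x \<in> ?\<Omega>" for x
    using that cf by (intro precise_rep_eq) auto
  have fle: "\<bar>f x\<bar> \<le> x\<^sup>2" if "x \<in> ?\<Omega>" for x
    using f[OF that] by (simp add: abs_mult mult_left_le)

  have "Lp_differentiable_at 1 ?\<Omega> f 0"
    unfolding Lp_differentiable_at_def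
  proof (intro conjI exI[of _ "\<lambda>_. 0"])
    show "Lp_loc 1 ?\<Omega> f" using cf by (rule Lp_loc_1_if_continuous_on)
    let ?A = "\<lambda>r. ball_avg (\<lambda>z::real. \<bar>f z - precise_rep f 0 - 0\<bar> powr 1 / r powr 1) 0 r"
    \<comment> \<open>On the ball \<open>\<bar>f z\<bar> \<le> r * r\<close>, and dividing by
      \<open>r\<close> leaves \<open>r\<close>.\<close>
    have "\<bar>?A r\<bar> \<le> r" if r: "0 < r" "r < 1" for r
    proof (rule abs_ball_avg_le[OF r(1)])
      fix z :: real assume z: "z \<in> ball 0 r"
      then have "z \<in> ?\<Omega>" using r by auto
      then have "\<bar>f z\<bar> \<le> \<bar>z\<bar> * \<bar>z\<bar>" using fle[of z] by (simp add: power2_eq_square)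
      also have "\<dots> \<le> r * r" using z by (intro mult_mono) auto
      finally show "\<bar>\<bar>f z - precise_rep f 0 - 0\<bar> powr 1 / r powr 1\<bar> \<le> r"
        using r pr[of 0] assms(2) by (simp add: divide_le_eq)
    qed
    then have "\<forall>\<^sub>F r in at_right 0. norm (?A r) \<le> r"
      by (auto simp: eventually_at_right_field intro!: exI[of _ 1])
    then show "(?A \<longlongrightarrow> 0) (at_right 0)"
      by (rule Lim_null_comparison) (rule tendsto_ident_at)
  qed (auto intro: linear_zero)

  \<comment> \<open>Together with the next conjunct this shows that \<open>f\<close> meets the
    preconditions of \<open>W1p_differentiable_at\<close>, so that only the limit can fail.\<close>
  moreover have "W1p_loc 1 ?\<Omega> f"
    unfolding W1p_loc_def W1p_on_def Lp_on_1_iff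
  proof (intro allI impI, elim conjE, intro conjI ballI)
    fix V :: "real set"
    assume V: "open V" "compact (closure V)" "closure V \<subseteq> ?\<Omega>"
    have V\<Omega>: "V \<subseteq> ?\<Omega>" using V(3) closure_subset by blast
    have Vb: "bounded V"
      using bounded_subset[OF compact_imp_bounded[OF V(2)] closure_subset] .
    have Vm: "V \<in> lmeasurable"
      using V(1) Vb by (intro lmeasurable_open)
    show "integrable (lebesgue_on V) f"
    proof (rule integrable_lebesgue_on_if_bounded[OF Vm])
      show "f \<in> borel_measurable (lebesgue_on V)"
        using cf V\<Omega> V(1) by (intro continuous_imp_measurable_on_sets_lebesgue)
          (auto intro: continuous_on_subset)
      show "\<bar>f x\<bar> \<le> 1" if "x \<in> V" for x
      proof -
        have "x \<in> ?\<Omega>" using that V\<Omega> by blast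
        moreover from this have "x\<^sup>2 \<le> 1" by (auto simp: abs_square_le_1)
        ultimately show ?thesis using fle by fastforce
      qed
    qed
    have "Lp_loc 1 V osc_deriv"
      using integrable_osc_deriv[of _ 1 0]
      by (auto simp: Lp_loc_def Lp_on_1_iff lmeasurable_compact compact_imp_bounded)
    then have "is_weak_partial V 1 f osc_deriv"
      using df V\<Omega> V(1) by (intro is_weak_partial_if_DERIV) auto
    then show "\<exists>g. is_weak_partial V b f g \<and> integrable (lebesgue_on V) g" if "b \<in> Basis" for b
      using that integrable_osc_deriv[OF Vm Vb, of 1 0] by (auto simp: Basis_real_def)
  qed

  moreover have "Lp_point 1 ?\<Omega> f 0"
    using cf by (intro Lp_point_1_if_continuous_on) auto

  moreover have "\<not> W1p_differentiable_at 1 ?\<Omega> f 0"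
  proof
    assume "W1p_differentiable_at 1 ?\<Omega> f 0"
    then obtain L where L: "linear L" and lim: "\<And>U. open U \<and> bounded U \<Longrightarrow>
        ((\<lambda>h. W1p_norm 1 U (\<lambda>z. diff_quot f 0 h z - L z)) \<longlongrightarrow> 0) (at 0)"
      unfolding W1p_differentiable_at_def by blast
    define c where "c = L 1"
    have Lz: "L z = c * z" for z
      using linear_scale[OF L, of z 1] by (simp add: c_def)
    let ?U = "{1<..<2::real}"
    let ?R = "\<lambda>h. (1 / 2 + c\<^sup>2 - (9 / 4 + 18 * \<bar>c\<bar>) * h) / (1 + \<bar>c\<bar>) - 4 * h"
    let ?N = "\<lambda>h. W1p_norm 1 ?U (\<lambda>z. diff_quot f 0 h z - L z)"
    \<comment> \<open>\<open>h < 1 / 2\<close> and \<open>z < 2\<close> place \<open>h * z\<close>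
      in \<open>(0, 1)\<close>, where the precise representative is \<open>f\<close>.\<close>
    have "?R h \<le> ?N h" if h: "0 < h" "h < 1 / 2" for h
    proof -
      define u where "u z = diff_quot f 0 h z - L z" for z
      have u: "u z = (h * z)\<^sup>2 * sin (1 / (h * z)) / h - c * z" if "z \<in> ?U" for z
      proof -
        have "h * z < 1 / 2 * 2" using that h by (intro mult_strict_mono) auto
        moreover have "0 < h * z" using that h by simp
        ultimately show ?thesis
          by (simp add: u_def diff_quot_def pr f Lz)
      qed
      have du: "(u has_real_derivative osc_deriv (h * z) - c) (at z)" if z: "z \<in> ?U" for z
      proof (rule has_field_derivative_transform_within_open[OF _ open_greaterThanLessThan z])
        have "((\<lambda>z. h * z) has_real_derivative h) (at z)"
          by (auto intro!: derivative_eq_intros)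
        from DERIV_diff[OF DERIV_cdivide[OF DERIV_chain2[OF DERIV_osc this], of h] DERIV_cmult[OF DERIV_ident, of c]]
        show "((\<lambda>z. (h * z)\<^sup>2 * sin (1 / (h * z)) / h - c * z) has_real_derivative osc_deriv (h * z) - c) (at z)"
          using h by simp
      qed (simp add: u)
      have "Lp_loc 1 ?U (\<lambda>z. osc_deriv (h * z) - c)"
        using integrable_osc_deriv[of _ h c]
        by (auto simp: Lp_loc_def Lp_on_1_iff lmeasurable_compact compact_imp_bounded)
      then have w: "is_weak_partial ?U 1 u (\<lambda>z. osc_deriv (h * z) - c)"
        using du by (intro is_weak_partial_if_DERIV) auto
      \<comment> \<open>\<open>g\<close> is the unspecified choice inside the norm; the classical
        derivative witnesses that a weak one exists, and uniqueness identifies the two almost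
        everywhere.\<close>
      define g where "g = weak_partial ?U 1 u"
      have g: "is_weak_partial ?U 1 u g"
        unfolding g_def weak_partial_def using w by (rule someI[of "is_weak_partial ?U 1 u"])
      have ae: "AE z in lebesgue_on ?U. g z = osc_deriv (h * z) - c"
        by (rule weak_partial_unique[OF _ g w]) simp
      have "?R h \<le> (LINT z|lebesgue_on ?U. \<bar>osc_deriv (h * z) - c\<bar>)" by (rule integral_abs_osc_deriv_ge[OF h(1)])
      also have "\<dots> = Lp_norm 1 ?U g"
        unfolding Lp_norm_1
      proof (rule integral_cong_AE)
        have m: "(\<lambda>z. osc_deriv (h * z) - c) \<in> borel_measurable (lebesgue_on ?U)"
          by (intro borel_measurable_integrable integrable_osc_deriv) auto
        show "(\<lambda>z. \<bar>osc_deriv (h * z) - c\<bar>) \<in> borel_measurable (lebesgue_on ?U)"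
          using m by (rule borel_measurable_abs)
        \<comment> \<open>Lebesgue measure is complete, so \<open>g\<close> inherits measurability
          on \<open>?U\<close> from the function it equals almost everywhere.\<close>
        have "AE z in lebesgue. z \<in> ?U \<longrightarrow> g z = osc_deriv (h * z) - c"
          using ae by (simp add: AE_restrict_space_iff)
        then have "AE z in lebesgue. (if z \<in> ?U then osc_deriv (h * z) - c else 0) = (if z \<in> ?U then g z else 0)"
          by eventually_elim simp
        from borel_measurable_AE[OF borel_measurable_if_I[OF m] this]
        have "g \<in> borel_measurable (lebesgue_on ?U)"
          by (intro borel_measurable_if_D) simp
        then show "(\<lambda>z. \<bar>g z\<bar>) \<in> borel_measurable (lebesgue_on ?U)"
          by (rule borel_measurable_abs)
        show "AE z in lebesgue_on ?U. \<bar>osc_deriv (h * z) - c\<bar> = \<bar>g z\<bar>"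
          using ae by eventually_elim simp
      qed
      \<comment> \<open>The norm of \<open>u\<close> itself is nonnegative and is dropped.\<close>
      also have "\<dots> \<le> W1p_norm 1 ?U u"
        by (simp add: W1p_norm_def g_def Basis_real_def Lp_norm_def)
      finally show ?thesis by (simp add: u_def[abs_def])
    qed
    then have "\<forall>\<^sub>F h in at_right 0. ?R h \<le> ?N h"
      by (auto simp: eventually_at_right_field intro!: exI[of _ "1 / 2"])
    \<comment> \<open>The lower bound holds for \<open>h > 0\<close>, so the two-sided limit is
      restricted to the right; passing to it would force
      \<open>(1 / 2 + c\<^sup>2) / (1 + \<bar>c\<bar>) \<le> 0\<close>.\<close>
    moreover have "(?N \<longlongrightarrow> 0) (at_right 0)"
      using lim[of ?U] by (simp only: filterlim_at_split) simp
    moreover have "(?R \<longlongrightarrow> (1 / 2 + c\<^sup>2 - (9 / 4 + 18 * \<bar>c\<bar>) * 0) / (1 + \<bar>c\<bar>) - 4 * 0) (at_right 0)"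
      by (intro tendsto_intros) auto
    ultimately have "(1 / 2 + c\<^sup>2 - (9 / 4 + 18 * \<bar>c\<bar>) * 0) / (1 + \<bar>c\<bar>) - 4 * 0 \<le> 0"
      using tendsto_le[OF trivial_limit_at_right_real] by blast
    moreover have "(1 / 2 + c\<^sup>2) / (1 + \<bar>c\<bar>) > 0"
      by (intro divide_pos_pos add_pos_nonneg) auto
    ultimately show False by simp
  qed
  ultimately show ?thesis by blast
qed

end
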